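(* Let $M$ be a vf-safe $\Delta$-matroid over $V$ and let $u\in V$. If $u$ is neither a loop nor a coloop of $M\bar{*}V$, then $P_M(y)=P_{M*u\setminus u}(y)-P_{M\bar{*}u\setminus u}(y)$. If $u$ is a coloop of $M\bar{*}V$, then $P_M(y)=(1-y)P_{M*u\setminus u}(y)$. If $u$ is a loop of $M\bar{*}V$, then $P_M(y)=(y-1)P_{M\bar{*}u\setminus u}(y)$. Finally, if $V=\emptyset$ then $P_M(y)=1$.
   Context: A set system is $N=(W,D)$ with $D\subseteq 2^W$, proper if $D\neq\emptyset$. Twist $N*X=(W,\{Y\triangle X:Y\in D\})$; loop complementation $N+X=(W,D')$ with $Y\in D'$ iff the number of $Z\in D$ with $Y\setminus X\subseteq Z\subseteq Y$ is odd; dual pivot $N\bar{*}X=(W,D'')$ with $Y\in D''$ iff the number of $Z\in D$ with $Y\subseteq Z\subseteq Y\cup X$ is odd; for $u\in W$, $N*u=N*\{u\}$, $N\bar*u=N\bar*\{u\}$; deletion $N\setminus u=(W\setminus\{u\},\{Y\in D:u\notin Y\})$; operations are applied left to right. $u$ is a loop of $N$ if no member contains $u$, a coloop if all members contain $u$. A $\Delta$-matroid is a proper set system such that for all $X,Y\in D$, $x\in X\triangle Y$ there is $y\in X\triangle Y$ (possibly $y=x$) with $X\triangle\{x,y\}\in D$; it is vf-safe if all set systems obtained from it by finite sequences of twists and loop complementations are $\Delta$-matroids. $d_N=\min\{|Y|:Y\in D\}$. For a set system $N$ over $W$, $P_N(y)=\sum_{X\subseteq W}(-1)^{|X|}y^{d_{N*W\bar{*}X}}$.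 *)

theory Defs
  imports "HOL-Computational_Algebra.Polynomial"
begin

type_synonym 'a set_system = "'a set \<times> 'a set set"

abbreviation ground :: "'a set_system \<Rightarrow> 'a set" where
  "ground N \<equiv> fst N"

abbreviation members :: "'a set_system \<Rightarrow> 'a set set" where
  "members N \<equiv> snd N"

text \<open>Ground sets are finite, as is needed for the parities, minima and sums below.\<close>

definition set_system :: "'a set_system \<Rightarrow> bool" where
  "set_system N \<longleftrightarrow> finite (ground N) \<and> members N \<subseteq> Pow (ground N)"

definition proper :: "'a set_system \<Rightarrow> bool" where
  "proper N \<longleftrightarrow> members N \<noteq> {}"

definition twist :: "'a set_system \<Rightarrow> 'a set \<Rightarrow> 'a set_system" where
  "twist N X = (ground N, {sym_diff Y X |Y. Y \<in> members N})"

definition loop_compl :: "'a set_system \<Rightarrow> 'a set \<Rightarrow> 'a set_system" where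
  "loop_compl N X =
     (ground N,
      {Y. Y \<subseteq> ground N \<and> odd (card {Z \<in> members N. Y - X \<subseteq> Z \<and> Z \<subseteq> Y})})"

definition dual_pivot :: "'a set_system \<Rightarrow> 'a set \<Rightarrow> 'a set_system" where
  "dual_pivot N X =
     (ground N,
      {Y. Y \<subseteq> ground N \<and> odd (card {Z \<in> members N. Y \<subseteq> Z \<and> Z \<subseteq> Y \<union> X})})"

definition deletion :: "'a set_system \<Rightarrow> 'a \<Rightarrow> 'a set_system" where
  "deletion N u = (ground N - {u}, {Y \<in> members N. u \<notin> Y})"

definition is_loop :: "'a set_system \<Rightarrow> 'a \<Rightarrow> bool" where
  "is_loop N u \<longleftrightarrow> u \<in> ground N \<and> (\<forall>Y \<in> members N. u \<notin> Y)"

definition is_coloop :: "'a set_system \<Rightarrow> 'a \<Rightarrow> bool" where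
  "is_coloop N u \<longleftrightarrow> u \<in> ground N \<and> (\<forall>Y \<in> members N. u \<in> Y)"

definition delta_matroid :: "'a set_system \<Rightarrow> bool" where
  "delta_matroid N \<longleftrightarrow> set_system N \<and> proper N \<and>
     (\<forall>X \<in> members N. \<forall>Y \<in> members N. \<forall>x \<in> sym_diff X Y.
        \<exists>y \<in> sym_diff X Y. sym_diff X {x, y} \<in> members N)"

inductive_set vf_reachable :: "'a set_system \<Rightarrow> 'a set_system set"
  for M :: "'a set_system" where
  base: "M \<in> vf_reachable M"
| twist: "N \<in> vf_reachable M \<Longrightarrow> X \<subseteq> ground N \<Longrightarrow> twist N X \<in> vf_reachable M"
| loop_compl: "N \<in> vf_reachable M \<Longrightarrow> X \<subseteq> ground N \<Longrightarrow> loop_compl N X \<in> vf_reachable M"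

definition vf_safe :: "'a set_system \<Rightarrow> bool" where
  "vf_safe M \<longleftrightarrow> (\<forall>N \<in> vf_reachable M. delta_matroid N)"

text \<open>Only meaningful for proper set systems over a finite ground set.\<close>

definition min_card :: "'a set_system \<Rightarrow> nat" where
  "min_card N = Min (card ` members N)"

definition P_poly :: "'a set_system \<Rightarrow> int poly" where
  "P_poly N =
     (\<Sum>X \<in> Pow (ground N).
        (-1) ^ card X * [:0, 1:] ^ min_card (dual_pivot (twist N (ground N)) X))"

end

theory Submission
  imports Defs
begin

text \<open>Write \<open>N \<star> X\<close> for the dual pivot and \<open>A\<^sub>X = M * V \<star> X\<close>. Splitting the sum defining \<open>P\<^sub>M\<close> according
  to whether \<open>u \<in> X\<close> pairs \<open>A\<^sub>X\<close> with \<open>A\<^sub>X \<star> u\<close> for \<open>X \<subseteq> V - {u}\<close>, while the polynomials of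
  \<open>M * u\<close> and \<open>M \<star> u\<close> with \<open>u\<close> deleted are the sums over the same \<open>X\<close> for \<open>A\<^sub>X\<close> and \<open>A\<^sub>X \<star> u\<close> with
  \<open>u\<close> deleted. All \<open>A\<^sub>X\<close> and \<open>A\<^sub>X \<star> u\<close> are \<open>\<Delta>\<close>-matroids, and by exchange, deleting \<open>u\<close> from a
  \<open>\<Delta>\<close>-matroid with a member avoiding \<open>u\<close> does not change the minimum cardinality. If no member of
  \<open>A\<^sub>X\<close> avoids \<open>u\<close>, then its members are the \<open>Y \<union> {u}\<close> with \<open>Y\<close> a member of \<open>A\<^sub>X \<star> u\<close> avoiding \<open>u\<close>,
  so its minimum is larger by one; this, and the same statement with \<open>A\<^sub>X\<close> and \<open>A\<^sub>X \<star> u\<close> exchanged,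
  gives the loop and the coloop case.\<close>

section \<open>Membership and closure rules for the operations\<close>

lemma ground_simps [simp]:
  "ground (twist N X) = ground N"
  "ground (loop_compl N X) = ground N"
  "ground (dual_pivot N X) = ground N"
  "ground (deletion N u) = ground N - {u}"
  by (simp_all add: twist_def loop_compl_def dual_pivot_def deletion_def)

lemma mem_twist: "Y \<in> members (twist N X) \<longleftrightarrow> sym_diff Y X \<in> members N"
proof -
  have "Y = sym_diff Z X \<longleftrightarrow> Z = sym_diff Y X" for Z by blast
  then show ?thesis unfolding twist_def snd_conv mem_Collect_eq by simp
qed

lemma mem_deletion: "Y \<in> members (deletion N u) \<longleftrightarrow> Y \<in> members N \<and> u \<notin> Y"
  by (auto simp: deletion_def)

lemma mem_dual_pivot:
  "Y \<in> members (dual_pivot N X) \<longleftrightarrow>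
     Y \<subseteq> ground N \<and> odd (card {Z \<in> members N. Y \<subseteq> Z \<and> Z \<subseteq> Y \<union> X})"
  by (simp add: dual_pivot_def)

lemma mem_loop_compl:
  "Y \<in> members (loop_compl N X) \<longleftrightarrow>
     Y \<subseteq> ground N \<and> odd (card {Z \<in> members N. Y - X \<subseteq> Z \<and> Z \<subseteq> Y})"
  by (simp add: loop_compl_def)

lemma set_system_finite_members: "set_system N \<Longrightarrow> finite (members N)"
  unfolding set_system_def using finite_subset by auto

lemma set_system_member_subset: "set_system N \<Longrightarrow> Y \<in> members N \<Longrightarrow> Y \<subseteq> ground N"
  unfolding set_system_def by auto

lemma set_system_finite_member: "set_system N \<Longrightarrow> Y \<in> members N \<Longrightarrow> finite Y"
  unfolding set_system_def by (auto intro: finite_subset)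

lemma set_system_dual_pivot: "set_system N \<Longrightarrow> set_system (dual_pivot N X)"
  unfolding set_system_def dual_pivot_def by auto

lemma set_system_deletion: "set_system N \<Longrightarrow> set_system (deletion N u)"
  unfolding set_system_def deletion_def by auto

lemma set_system_twist: "set_system N \<Longrightarrow> X \<subseteq> ground N \<Longrightarrow> set_system (twist N X)"
  unfolding set_system_def twist_def by auto

section \<open>Composition, deletion and maximal members under dual pivots\<close>

lemma dual_pivot_empty [simp]: "set_system N \<Longrightarrow> dual_pivot N {} = N"
proof (rule prod_eqI)
  assume N: "set_system N"
  have "{Z \<in> members N. Y \<subseteq> Z \<and> Z \<subseteq> Y \<union> {}} = (if Y \<in> members N then {Y} else {})" for Y
    by auto
  then show "members (dual_pivot N {}) = members N"
    using set_system_member_subset[OF N] by (auto simp: dual_pivot_def split: if_splits)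
qed simp

text \<open>The intervals \<open>[T, T \<union> X]\<close> with
  \<open>Y \<subseteq> T \<subseteq> Y \<union> X'\<close> partition
  \<open>[Y, Y \<union> X \<union> X']\<close>: by disjointness, \<open>Z\<close> lies only in the
  one with \<open>T = Z \<inter> (Y \<union> X')\<close>. Counting members of \<open>N\<close>
  fibrewise compares the parities.\<close>

lemma dual_pivot_dual_pivot_disjoint:
  assumes N: "set_system N" and disj: "X \<inter> X' = {}" and X': "X' \<subseteq> ground N"
  shows "dual_pivot (dual_pivot N X) X' = dual_pivot N (X \<union> X')"
proof (rule prod_eqI)
  have "Y \<in> members (dual_pivot (dual_pivot N X) X') \<longleftrightarrow> Y \<in> members (dual_pivot N (X \<union> X'))"
    if Y: "Y \<subseteq> ground N" for Y
  proof -
    let ?I = "{T. Y \<subseteq> T \<and> T \<subseteq> Y \<union> X'}"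
    let ?F = "\<lambda>T. {Z \<in> members N. T \<subseteq> Z \<and> Z \<subseteq> T \<union> X}"
    have fin: "finite ?I"
      using N Y X' by (auto simp: set_system_def intro!: finite_subset[of _ "Pow (ground N)"])
    have finF: "finite (?F T)" for T
      using set_system_finite_members[OF N] by simp
    have fibre: "T = Z \<inter> (Y \<union> X')" if "T \<in> ?I" "Z \<in> ?F T" for T Z
      using that disj by blast
    have "{Z \<in> members N. Y \<subseteq> Z \<and> Z \<subseteq> Y \<union> (X \<union> X')} = (\<Union>T\<in>?I. ?F T)" (is "?L = ?R")
    proof
      show "?L \<subseteq> ?R"
      proof
        fix Z assume "Z \<in> ?L"
        then have "Z \<inter> (Y \<union> X') \<in> ?I" "Z \<in> ?F (Z \<inter> (Y \<union> X'))" by auto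
        then show "Z \<in> ?R" by blast
      qed
    qed auto
    moreover have "card (\<Union>T\<in>?I. ?F T) = (\<Sum>T\<in>?I. card (?F T))"
    proof (rule card_UN_disjoint)
      show "\<forall>T\<in>?I. \<forall>T'\<in>?I. T \<noteq> T' \<longrightarrow> ?F T \<inter> ?F T' = {}"
        using fibre by (metis (no_types, lifting) disjoint_iff)
    qed (use fin finF in auto)
    \<comment> \<open>A sum is odd iff an odd number of its terms are, and the odd fibres are
      exactly the \<open>T\<close> in the inner dual pivot.\<close>
    moreover have "odd (\<Sum>T\<in>?I. card (?F T)) \<longleftrightarrow> odd (card {T\<in>?I. odd (card (?F T))})"
      using fin by (simp add: even_sum_iff)
    moreover have "{T\<in>?I. odd (card (?F T))} =
        {T \<in> members (dual_pivot N X). Y \<subseteq> T \<and> T \<subseteq> Y \<union> X'}"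
      using Y X' by (auto simp: mem_dual_pivot)
    ultimately show ?thesis
      using Y by (simp add: mem_dual_pivot[of Y])
  qed
  moreover have "Y \<notin> members (dual_pivot (dual_pivot N X) X')" "Y \<notin> members (dual_pivot N (X \<union> X'))"
    if "\<not> Y \<subseteq> ground N" for Y
    using that by (simp_all only: mem_dual_pivot[of Y] ground_simps simp_thms)
  ultimately show "members (dual_pivot (dual_pivot N X) X') = members (dual_pivot N (X \<union> X'))"
    by (intro set_eqI) metis
qed simp

text \<open>If \<open>u\<close> is in neither \<open>Y\<close> nor \<open>X\<close>, no set in
  \<open>[Y, Y \<union> X]\<close> contains \<open>u\<close>, so the parity sees only members that
  survive the deletion.\<close>

lemma deletion_dual_pivot:
  assumes "u \<notin> X"
  shows "deletion (dual_pivot N X) u = dual_pivot (deletion N u) X"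
proof (rule prod_eqI)
  have "{Z \<in> members N. Y \<subseteq> Z \<and> Z \<subseteq> Y \<union> X} = {Z \<in> members (deletion N u). Y \<subseteq> Z \<and> Z \<subseteq> Y \<union> X}"
    if "u \<notin> Y" for Y
    using that assms by (auto simp: mem_deletion)
  then have "Y \<in> members (deletion (dual_pivot N X) u) \<longleftrightarrow> Y \<in> members (dual_pivot (deletion N u) X)" for Y
    by (cases "u \<in> Y") (auto simp: mem_deletion[of _ "dual_pivot N X"] mem_dual_pivot)
  then show "members (deletion (dual_pivot N X) u) = members (dual_pivot (deletion N u) X)"
    by blast
qed simp

text \<open>The count at a maximal member is 1, so maximal members survive every dual pivot.\<close>

lemma maximal_in_dual_pivot:
  assumes "set_system N" "Z \<in> members N" "\<And>Z'. Z' \<in> members N \<Longrightarrow> Z \<subseteq> Z' \<Longrightarrow> Z' = Z"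
  shows "Z \<in> members (dual_pivot N X)"
proof -
  have "{Z' \<in> members N. Z \<subseteq> Z' \<and> Z' \<subseteq> Z \<union> X} = {Z}"
    using assms by auto
  then show ?thesis
    using assms by (simp add: mem_dual_pivot set_system_member_subset)
qed

lemma dual_pivot_above_subset:
  "Y \<in> members (dual_pivot N X) \<Longrightarrow> \<exists>Z \<in> members N. Y \<subseteq> Z"
  unfolding mem_dual_pivot by (metis (no_types, lifting) Collect_empty_eq card.empty even_zero)

lemma ex_maximal_above:
  assumes "set_system N" "Y \<in> members N"
  obtains Z where "Z \<in> members N" "Y \<subseteq> Z" "\<And>Z'. Z' \<in> members N \<Longrightarrow> Z \<subseteq> Z' \<Longrightarrow> Z' = Z"
  using finite_has_maximal2[OF set_system_finite_members[OF assms(1)] assms(2)] by metis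

text \<open>An odd count is nonzero, so pivoted members lie below old ones; conversely, pass to a
  maximal member. The case \<open>S = {}\<close> transfers emptiness, and \<open>S = {u}\<close>
  detects loops.\<close>

lemma dual_pivot_above_iff:
  assumes "set_system N"
  shows "(\<exists>Y \<in> members (dual_pivot N X). S \<subseteq> Y) \<longleftrightarrow> (\<exists>Y \<in> members N. S \<subseteq> Y)"
  by (meson assms dual_pivot_above_subset ex_maximal_above maximal_in_dual_pivot subset_trans)

lemma members_dual_pivot_eq_empty_iff:
  "set_system N \<Longrightarrow> members (dual_pivot N X) = {} \<longleftrightarrow> members N = {}"
  using dual_pivot_above_iff[of N "{}" X] dual_pivot_above_iff[of N X "{}"] by auto

section \<open>Dual pivot on a single element\<close>

lemma mem_dual_pivot_singleton:
  assumes "set_system N" "u \<in> ground N"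
  shows "Y \<in> members (dual_pivot N {u}) \<longleftrightarrow>
    (if u \<in> Y then Y \<in> members N else (Y \<in> members N) \<noteq> (insert u Y \<in> members N))"
proof (cases "u \<in> Y")
  case True
  then have "{Z \<in> members N. Y \<subseteq> Z \<and> Z \<subseteq> Y \<union> {u}} = (if Y \<in> members N then {Y} else {})"
    by (auto simp: insert_absorb dest: subset_antisym)
  then show ?thesis
    using True set_system_member_subset[OF assms(1)] by (auto simp: mem_dual_pivot)
next
  case False
  have "Y \<subseteq> Z \<and> Z \<subseteq> Y \<union> {u} \<longleftrightarrow> Z = Y \<or> Z = insert u Y" for Z
    by blast
  then have "{Z \<in> members N. Y \<subseteq> Z \<and> Z \<subseteq> Y \<union> {u}} =
     (if Y \<in> members N then {Y} else {}) \<union> (if insert u Y \<in> members N then {insert u Y} else {})"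
    by auto
  moreover have "Y \<noteq> insert u Y" using False by auto
  ultimately show ?thesis
    using False set_system_member_subset[OF assms(1)] by (auto simp: mem_dual_pivot)
qed

lemma dual_pivot_singleton_involutive:
  assumes "set_system N" "u \<in> ground N"
  shows "dual_pivot (dual_pivot N {u}) {u} = N"
  using assms
  by (intro prod_eqI set_eqI) (auto simp: mem_dual_pivot_singleton set_system_dual_pivot)

section \<open>Dual pivots and vf-safety\<close>

lemma dual_pivot_eq_twist_loop_compl_twist:
  assumes N: "set_system N" and X: "X \<subseteq> ground N"
  shows "dual_pivot N X = twist (loop_compl (twist N X) X) X"
proof (rule prod_eqI)
  \<comment> \<open>Symmetric difference with \<open>X\<close> reverses inclusion inside
    \<open>X\<close> and changes nothing outside, so it carries the upward interval at
    \<open>Y\<close> to the downward interval at \<open>sym_diff Y X\<close>.\<close>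
  have "card {Z \<in> members N. Y \<subseteq> Z \<and> Z \<subseteq> Y \<union> X} =
    card {Z \<in> members (twist N X). sym_diff Y X - X \<subseteq> Z \<and> Z \<subseteq> sym_diff Y X}" for Y
  proof (rule bij_betw_same_card[OF bij_betw_byWitness[where f = "\<lambda>Z. sym_diff Z X" and f' = "\<lambda>Z. sym_diff Z X"]])
    have inv: "sym_diff (sym_diff Z X) X = Z" for Z by blast
    show "(\<lambda>Z. sym_diff Z X) ` {Z \<in> members N. Y \<subseteq> Z \<and> Z \<subseteq> Y \<union> X}
       \<subseteq> {Z \<in> members (twist N X). sym_diff Y X - X \<subseteq> Z \<and> Z \<subseteq> sym_diff Y X}"
      unfolding mem_twist by (auto simp: inv)
    show "(\<lambda>Z. sym_diff Z X) ` {Z \<in> members (twist N X). sym_diff Y X - X \<subseteq> Z \<and> Z \<subseteq> sym_diff Y X}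
       \<subseteq> {Z \<in> members N. Y \<subseteq> Z \<and> Z \<subseteq> Y \<union> X}"
      unfolding mem_twist by auto
  qed blast+
  moreover have "sym_diff Y X \<subseteq> ground N \<longleftrightarrow> Y \<subseteq> ground N" for Y
    using X by blast
  ultimately have "Y \<in> members (dual_pivot N X) \<longleftrightarrow>
      Y \<in> members (twist (loop_compl (twist N X) X) X)" for Y
    by (simp only: mem_dual_pivot mem_twist[of _ "loop_compl (twist N X) X"] mem_loop_compl
        ground_simps)
  then show "members (dual_pivot N X) = members (twist (loop_compl (twist N X) X) X)"
    by blast
qed simp

lemma delta_matroid_dual_pivot_reachable:
  assumes "vf_safe M" "N \<in> vf_reachable M" "X \<subseteq> ground N"
  shows "delta_matroid (dual_pivot N X)"
proof -
  have "set_system N"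
    using assms by (auto simp: vf_safe_def delta_matroid_def)
  then have "dual_pivot N X \<in> vf_reachable M"
    using assms
    by (subst dual_pivot_eq_twist_loop_compl_twist) (auto intro!: vf_reachable.intros(2,3))
  then show ?thesis
    using assms(1) by (auto simp: vf_safe_def)
qed

section \<open>Minimum cardinality under deletion\<close>

lemma min_card_deletion:
  assumes A: "delta_matroid A" and ne: "members (deletion A u) \<noteq> {}"
  shows "min_card (deletion A u) = min_card A"
proof -
  have ss: "set_system A" using A by (simp add: delta_matroid_def)
  have fin: "finite (members A)" "finite (members (deletion A u))"
    using ss by (simp_all add: set_system_finite_members set_system_deletion)
  obtain X where X: "X \<in> members A" "u \<notin> X"
    using ne by (auto simp: mem_deletion)
  have "\<exists>Z \<in> members (deletion A u). card Z \<le> card Y" if Y: "Y \<in> members A" for Y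
  proof (cases "u \<in> Y")
    case True
    \<comment> \<open>Exchange at \<open>u\<close> towards \<open>X\<close>, which avoids
      \<open>u\<close>: the new member loses \<open>u\<close> and gains at most \<open>y\<close>, so
      it is no larger than \<open>Y\<close>.\<close>
    then obtain y where y: "sym_diff Y {u, y} \<in> members A" "y \<in> sym_diff Y X"
      using A X Y unfolding delta_matroid_def by blast
    have finY: "finite Y" using ss Y by (rule set_system_finite_member)
    have "card (sym_diff Y {u, y}) \<le> card (insert y (Y - {u}))"
      by (rule card_mono) (use finY True in auto)
    also have "\<dots> \<le> Suc (card (Y - {u}))"
      by (rule card_insert_le_m1) auto
    also have "\<dots> = card Y"
      using finY True by (rule card_Suc_Diff1)
    finally have "card (sym_diff Y {u, y}) \<le> card Y" .
    moreover have "u \<notin> sym_diff Y {u, y}" using True by blast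
    ultimately show ?thesis using y by (auto simp: mem_deletion)
  qed (auto simp: mem_deletion Y)
  then have "Min (card ` members (deletion A u)) \<le> Min (card ` members A)"
    using fin ne X by (intro Min.boundedI) (auto simp: Min_le_iff)
  moreover have "Min (card ` members A) \<le> Min (card ` members (deletion A u))"
    using fin ne by (intro Min_antimono) (auto simp: mem_deletion)
  ultimately show ?thesis
    by (simp add: min_card_def)
qed

text \<open>As all members contain \<open>u\<close>, only \<open>insert u Y\<close> can contribute
  to the parity at a \<open>Y\<close> avoiding \<open>u\<close>. Hence removing \<open>u\<close> is
  a bijection onto the deleted pivot that lowers every cardinality by one.\<close>

lemma min_card_of_deletion_empty:
  assumes A: "set_system A" and u: "u \<in> ground A" and ne: "members A \<noteq> {}"
    and del: "members (deletion A u) = {}"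
  shows "min_card A = Suc (min_card (deletion (dual_pivot A {u}) u))"
proof -
  let ?C = "deletion (dual_pivot A {u}) u"
  have uA: "u \<in> Y" if "Y \<in> members A" for Y
    using that del mem_deletion[of Y A u] by auto
  have C: "Y \<in> members ?C \<longleftrightarrow> u \<notin> Y \<and> insert u Y \<in> members A" for Y
    using uA[of Y] by (auto simp: mem_deletion mem_dual_pivot_singleton[OF A u])
  have "members A = insert u ` members ?C"
  proof (intro set_eqI iffI)
    fix Y assume "Y \<in> members A"
    then have "Y = insert u (Y - {u})" "Y - {u} \<in> members ?C"
      using uA[of Y] by (auto simp: C insert_absorb)
    then show "Y \<in> insert u ` members ?C" by blast
  qed (auto simp: C)
  moreover have "card (insert u Y) = Suc (card Y)" if "Y \<in> members ?C" for Y
    using that set_system_finite_member[OF A, of "insert u Y"] by (simp add: C)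
  ultimately have "card ` members A = Suc ` card ` members ?C"
    by (simp add: image_image)
  moreover have "Min (Suc ` card ` members ?C) = Suc (Min (card ` members ?C))"
    using ne A \<open>members A = insert u ` members ?C\<close>
    by (intro mono_Min_commute[symmetric] monoI)
      (auto intro!: set_system_finite_members set_system_deletion set_system_dual_pivot)
  ultimately show ?thesis
    by (simp add: min_card_def)
qed

section \<open>The two minors of \<open>M\<close> as deletions from its full twist\<close>

lemma twist_deletion_twist:
  assumes "u \<in> ground M"
  shows "twist (deletion (twist M {u}) u) (ground M - {u}) = deletion (twist M (ground M)) u"
proof (intro prod_eqI set_eqI)
  fix Y
  have "u \<notin> Y \<Longrightarrow> sym_diff (sym_diff Y (ground M - {u})) {u} = sym_diff Y (ground M)"
    and "u \<in> sym_diff Y (ground M - {u}) \<longleftrightarrow> u \<in> Y"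
    using assms by blast+
  then show "Y \<in> members (twist (deletion (twist M {u}) u) (ground M - {u})) \<longleftrightarrow>
    Y \<in> members (deletion (twist M (ground M)) u)"
    by (simp only: mem_twist mem_deletion) metis
qed simp

text \<open>For \<open>u \<notin> Y\<close>, twisting by the ground set swaps the roles of the two
  sets tested by the pivot at \<open>u\<close>, the one with and the one without \<open>u\<close>.
  The parity condition is symmetric in them.\<close>

lemma twist_deletion_dual_pivot:
  assumes M: "set_system M" and u: "u \<in> ground M"
  shows "twist (deletion (dual_pivot M {u}) u) (ground M - {u}) =
    deletion (dual_pivot (twist M (ground M)) {u}) u"
proof (intro prod_eqI set_eqI)
  fix Y
  let ?Y = "sym_diff Y (ground M - {u})"
  have N: "set_system (twist M (ground M))"
    using M by (simp add: set_system_twist)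
  have uY: "u \<in> ?Y \<longleftrightarrow> u \<in> Y"
    by blast
  have Y: "insert u ?Y = sym_diff Y (ground M)" "sym_diff (insert u Y) (ground M) = ?Y"
    if "u \<notin> Y"
    using u that by blast+
  have "?Y \<in> members (dual_pivot M {u}) \<longleftrightarrow> Y \<in> members (dual_pivot (twist M (ground M)) {u})"
    if "u \<notin> Y"
  proof -
    have "?Y \<in> members (dual_pivot M {u}) \<longleftrightarrow> (?Y \<in> members M) \<noteq> (insert u ?Y \<in> members M)"
      using that uY by (simp only: mem_dual_pivot_singleton[OF M u] if_False)
    also have "\<dots> \<longleftrightarrow> (Y \<in> members (twist M (ground M))) \<noteq> (insert u Y \<in> members (twist M (ground M)))"
      unfolding mem_twist Y[OF that] by blast
    also have "\<dots> \<longleftrightarrow> Y \<in> members (dual_pivot (twist M (ground M)) {u})"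
      using that u by (simp add: mem_dual_pivot_singleton[OF N])
    finally show ?thesis .
  qed
  then show "Y \<in> members (twist (deletion (dual_pivot M {u}) u) (ground M - {u})) \<longleftrightarrow>
    Y \<in> members (deletion (dual_pivot (twist M (ground M)) {u}) u)"
    unfolding mem_twist[of Y] mem_deletion uY by blast
qed simp

section \<open>Splitting the sum and the recursion for \<open>P_poly\<close>\<close>

lemma sum_Pow_remove:
  assumes "finite V" "u \<in> V"
  shows "(\<Sum>X\<in>Pow V. f X) = (\<Sum>X\<in>Pow (V - {u}). f X + f (insert u X))"
proof -
  let ?P = "Pow (V - {u})"
  have "Pow V = ?P \<union> insert u ` ?P"
    using assms Pow_insert[of u "V - {u}"] by (simp add: insert_absorb)
  moreover have "inj_on (insert u) ?P"
    by (rule inj_onI) blast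
  moreover have "?P \<inter> insert u ` ?P = {}"
    by blast
  ultimately show ?thesis
    using assms by (simp add: sum.union_disjoint sum.reindex sum.distrib)
qed

theorem theorem7:
  fixes M :: "'a set_system" and V :: "'a set"
  assumes "delta_matroid M" and "vf_safe M" and "ground M = V"
  shows "(\<forall>u \<in> V.
            (\<not> is_loop (dual_pivot M V) u \<and> \<not> is_coloop (dual_pivot M V) u \<longrightarrow>
               P_poly M = P_poly (deletion (twist M {u}) u) - P_poly (deletion (dual_pivot M {u}) u)) \<and>
            (is_coloop (dual_pivot M V) u \<longrightarrow>
               P_poly M = (1 - [:0, 1:]) * P_poly (deletion (twist M {u}) u)) \<and>
            (is_loop (dual_pivot M V) u \<longrightarrow>
               P_poly M = ([:0, 1:] - 1) * P_poly (deletion (dual_pivot M {u}) u))) \<and>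
         (V = {} \<longrightarrow> P_poly M = 1)"
proof (intro conjI ballI impI)
  have M: "set_system M"
    using assms by (simp add: delta_matroid_def)
  have finV: "finite V"
    using M assms(3) by (simp add: set_system_def)
  define N where "N = twist M V"
  have gN: "ground N = V"
    by (simp add: N_def assms)
  have N: "set_system N"
    using M assms by (simp add: N_def set_system_twist)
  let ?A = "dual_pivot N"
  have dm: "delta_matroid (?A X)" if "X \<subseteq> V" for X
    using that gN assms unfolding N_def
    by (intro delta_matroid_dual_pivot_reachable[of M] vf_reachable.intros) auto
  have Ane: "members (?A X) \<noteq> {}" if "X \<subseteq> V" for X
    using dm[OF that] by (simp add: delta_matroid_def proper_def)
  have Ass: "set_system (?A X)" for X
    using N by (rule set_system_dual_pivot)

  {
    fix u assume u: "u \<in> V"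
    let ?B = "\<lambda>X. ?A (insert u X)"
    let ?y = "[:0, 1:] :: int poly"
    let ?P = "Pow (V - {u})"
    \<comment> \<open>\<open>B1\<close> pairs the two summands by a pivot at \<open>u\<close> and
      \<open>B3\<close> reverses it; \<open>B2\<close> puts the pivot by \<open>X\<close> outermost,
      where it commutes with deleting \<open>u\<close>.\<close>
    have B1: "?B X = dual_pivot (?A X) {u}" and B2: "?B X = dual_pivot (?A {u}) X"
      and B3: "?A X = dual_pivot (?B X) {u}" if X: "X \<in> ?P" for X
    proof -
      show B1: "?B X = dual_pivot (?A X) {u}"
        using dual_pivot_dual_pivot_disjoint[OF N, of X "{u}"] X u gN
        by (simp add: subset_Diff_insert)
      show "?B X = dual_pivot (?A {u}) X"
        using dual_pivot_dual_pivot_disjoint[OF N, of "{u}" X] X u gN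
        by (simp add: subset_Diff_insert)
      show "?A X = dual_pivot (?B X) {u}"
        using B1 Ass u gN by (simp add: dual_pivot_singleton_involutive)
    qed
    have delA: "deletion (?A X) u = dual_pivot (deletion N u) X"
      and delB: "deletion (?B X) u = dual_pivot (deletion (?A {u}) u) X" if "X \<in> ?P" for X
      unfolding B2[OF that] using that by (auto intro!: deletion_dual_pivot)
    \<comment> \<open>Emptiness after deletion does not depend on \<open>X\<close>, so one case of
      the theorem governs all summands at once.\<close>
    have delA_empty: "members (deletion (?A X) u) = {} \<longleftrightarrow> members (deletion N u) = {}"
      and delB_empty: "members (deletion (?B X) u) = {} \<longleftrightarrow> members (deletion (?A {u}) u) = {}"
      if "X \<in> ?P" for X
      unfolding delA[OF that] delB[OF that] using N
      by (simp_all add: members_dual_pivot_eq_empty_iff set_system_deletion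
          set_system_dual_pivot)

    have PM: "P_poly M = (\<Sum>X\<in>?P. (-1) ^ card X * (?y ^ min_card (?A X) - ?y ^ min_card (?B X)))"
    proof -
      have "P_poly M = (\<Sum>X\<in>?P. (-1) ^ card X * ?y ^ min_card (?A X)
          + (-1) ^ card (insert u X) * ?y ^ min_card (?B X))"
        unfolding P_poly_def assms(3) N_def[symmetric] by (rule sum_Pow_remove[OF finV u])
      also have "\<dots> = (\<Sum>X\<in>?P. (-1) ^ card X * (?y ^ min_card (?A X) - ?y ^ min_card (?B X)))"
      proof (rule sum.cong)
        fix X assume "X \<in> ?P"
        then have "card (insert u X) = Suc (card X)"
          using finV by (auto intro!: card_insert_disjoint intro: finite_subset)
        then show "(-1) ^ card X * ?y ^ min_card (?A X)
            + (-1) ^ card (insert u X) * ?y ^ min_card (?B X)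
          = (-1) ^ card X * (?y ^ min_card (?A X) - ?y ^ min_card (?B X))"
          \<comment> \<open>Adjoining \<open>u\<close> flips the sign. The removed simp rules would
            expand products with \<open>[:0, 1:]\<close> into coefficients.\<close>
          by (simp add: right_diff_distrib del: mult_pCons_left mult_pCons_right)
      qed simp
      finally show ?thesis .
    qed
    have P1: "P_poly (deletion (twist M {u}) u) =
        (\<Sum>X\<in>?P. (-1) ^ card X * ?y ^ min_card (deletion (?A X) u))"
    proof -
      have "twist (deletion (twist M {u}) u) (V - {u}) = deletion N u"
        using twist_deletion_twist[of u M] u assms(3) by (simp add: N_def)
      then show ?thesis
        unfolding P_poly_def ground_simps assms(3)
        by (intro sum.cong) (simp_all only: delA)
    qed
    have P2: "P_poly (deletion (dual_pivot M {u}) u) =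
        (\<Sum>X\<in>?P. (-1) ^ card X * ?y ^ min_card (deletion (?B X) u))"
    proof -
      have "twist (deletion (dual_pivot M {u}) u) (V - {u}) = deletion (?A {u}) u"
        using twist_deletion_dual_pivot[OF M, of u] u assms(3) by (simp add: N_def)
      then show ?thesis
        unfolding P_poly_def ground_simps assms(3)
        by (intro sum.cong refl) (subst delB, simp_all only:)
    qed

    \<comment> \<open>Dual pivots preserve whether some member contains \<open>u\<close>, and
      complementing in \<open>V\<close> turns members of \<open>M\<close> containing
      \<open>u\<close> into members of \<open>N\<close> avoiding it.\<close>
    have loop: "is_loop (dual_pivot M V) u \<longleftrightarrow> members (deletion N u) = {}"
    proof -
      have "is_loop (dual_pivot M V) u \<longleftrightarrow> \<not> (\<exists>Y \<in> members (dual_pivot M V). {u} \<subseteq> Y)"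
        using u assms(3) by (auto simp: is_loop_def)
      also have "\<dots> \<longleftrightarrow> \<not> (\<exists>Y \<in> members M. {u} \<subseteq> Y)"
        by (simp only: dual_pivot_above_iff[OF M])
      also have "\<dots> \<longleftrightarrow> members (deletion N u) = {}"
      proof -
        have "(\<exists>Y \<in> members M. {u} \<subseteq> Y) \<longleftrightarrow> (\<exists>Y. Y \<in> members (deletion N u))"
        proof
          assume "\<exists>Y \<in> members M. {u} \<subseteq> Y"
          then obtain Y where Y: "Y \<in> members M" "u \<in> Y" by auto
          have "sym_diff (sym_diff Y V) V = Y" by blast
          with Y u have "sym_diff Y V \<in> members (deletion N u)"
            by (simp add: mem_deletion N_def mem_twist)
          then show "\<exists>Y. Y \<in> members (deletion N u)" by blast
        next
          assume "\<exists>Y. Y \<in> members (deletion N u)"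
          then show "\<exists>Y \<in> members M. {u} \<subseteq> Y"
            using u by (auto simp: mem_deletion N_def mem_twist intro!: bexI[rotated])
        qed
        then show ?thesis by blast
      qed
      finally show ?thesis .
    qed
    \<comment> \<open>Pivot at \<open>u\<close> first: the remaining pivot by \<open>V - {u}\<close>
      commutes with the deletion and preserves emptiness, as does the twist that leads to
      \<open>N\<close>.\<close>
    have coloop: "is_coloop (dual_pivot M V) u \<longleftrightarrow> members (deletion (?A {u}) u) = {}"
    proof -
      have "is_coloop (dual_pivot M V) u \<longleftrightarrow> members (deletion (dual_pivot M V) u) = {}"
        using u assms(3) mem_deletion[of _ "dual_pivot M V" u] by (auto simp: is_coloop_def)
      also have "\<dots> \<longleftrightarrow> members (deletion (dual_pivot (dual_pivot M {u}) (V - {u})) u) = {}"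
        using dual_pivot_dual_pivot_disjoint[OF M, of "{u}" "V - {u}"] u assms(3)
        by (auto simp: insert_absorb)
      also have "\<dots> \<longleftrightarrow> members (deletion (dual_pivot M {u}) u) = {}"
        using M by (simp add: deletion_dual_pivot members_dual_pivot_eq_empty_iff
            set_system_deletion set_system_dual_pivot)
      also have "\<dots> \<longleftrightarrow> members (twist (deletion (dual_pivot M {u}) u) (V - {u})) = {}"
        by (simp add: twist_def)
      also have "\<dots> \<longleftrightarrow> members (deletion (?A {u}) u) = {}"
        using twist_deletion_dual_pivot[OF M, of u] u assms(3) by (simp add: N_def)
      finally show ?thesis .
    qed

    have sub: "X \<subseteq> V" "insert u X \<subseteq> V" if "X \<in> ?P" for X
      using that u by auto
    have minA: "min_card (deletion (?A X) u) = min_card (?A X)"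
      if "X \<in> ?P" "members (deletion N u) \<noteq> {}" for X
      using min_card_deletion[OF dm[OF sub(1)]] that delA_empty[OF that(1)] by blast
    have minB: "min_card (deletion (?B X) u) = min_card (?B X)"
      if "X \<in> ?P" "members (deletion (?A {u}) u) \<noteq> {}" for X
      using min_card_deletion[OF dm[OF sub(2)]] that delB_empty[OF that(1)] by blast
    have minA': "min_card (?A X) = Suc (min_card (deletion (?B X) u))"
      if X: "X \<in> ?P" "members (deletion N u) = {}" for X
      using that u gN min_card_of_deletion_empty[OF Ass, of u X] Ane[OF sub(1)[OF X(1)]]
        delA_empty[OF X(1)] B1[OF X(1)] by simp
    have minB': "min_card (?B X) = Suc (min_card (deletion (?A X) u))"
      if X: "X \<in> ?P" "members (deletion (?A {u}) u) = {}" for X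
      using that u gN min_card_of_deletion_empty[OF Ass, of u "insert u X"] Ane[OF sub(2)[OF X(1)]]
        delB_empty[OF X(1)] B3[OF X(1)] by simp
    \<comment> \<open>This makes \<open>minA\<close> available in the coloop case and
      \<open>minB\<close> in the loop case. If all members of \<open>N\<close> contain
      \<open>u\<close>, removing \<open>u\<close> from one yields a member of the pivot avoiding
      \<open>u\<close>.\<close>
    have not_both: "members (deletion N u) \<noteq> {} \<or> members (deletion (?A {u}) u) \<noteq> {}"
    proof (rule ccontr)
      assume "\<not> ?thesis"
      then have eN: "members (deletion N u) = {}" and eA: "members (deletion (?A {u}) u) = {}"
        by auto
      obtain Y where Y: "Y \<in> members N"
        using Ane[of "{}"] N by auto
      have "u \<in> Y" "Y - {u} \<notin> members N"
        using Y eN mem_deletion[of Y N u] mem_deletion[of "Y - {u}" N u] by auto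
      then have "Y - {u} \<in> members (deletion (?A {u}) u)"
        using Y u gN N by (simp add: mem_deletion mem_dual_pivot_singleton insert_absorb)
      with eA show False by simp
    qed

    show "P_poly M = P_poly (deletion (twist M {u}) u) - P_poly (deletion (dual_pivot M {u}) u)"
      if "\<not> is_loop (dual_pivot M V) u \<and> \<not> is_coloop (dual_pivot M V) u"
      using that unfolding PM P1 P2 loop coloop sum_subtractf[symmetric]
      by (intro sum.cong) (simp_all add: minA minB right_diff_distrib)
    \<comment> \<open>Up to sign each summand is \<open>y^a - y^(a+1)\<close>, with \<open>a\<close>
      the minimum of the deleted \<open>?A X\<close>.\<close>
    show "P_poly M = (1 - ?y) * P_poly (deletion (twist M {u}) u)"
      if "is_coloop (dual_pivot M V) u"
      using that not_both unfolding PM P1 loop coloop sum_distrib_left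
      by (intro sum.cong)
        (simp_all add: minA minB' algebra_simps del: mult_pCons_left mult_pCons_right)
    \<comment> \<open>Here it is \<open>y^(b+1) - y^b\<close>, with \<open>b\<close> the minimum of
      the deleted \<open>?B X\<close>.\<close>
    show "P_poly M = (?y - 1) * P_poly (deletion (dual_pivot M {u}) u)"
      if "is_loop (dual_pivot M V) u"
      using that not_both unfolding PM P2 loop coloop sum_distrib_left
      by (intro sum.cong)
        (simp_all add: minA' minB[symmetric] algebra_simps del: mult_pCons_left mult_pCons_right)
  }

  assume "V = {}"
  \<comment> \<open>Properness forces the empty set to be the only member, leaving the single
    summand \<open>y^0\<close>.\<close>
  then have "members N = {{}}"
    using Ane[of "{}"] N gN set_system_member_subset[OF N] by auto
  then show "P_poly M = 1"
    unfolding P_poly_def assms(3) N_def[symmetric] using N \<open>V = {}\<close> by (simp add: min_card_def)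
qed

end
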